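(* Let $F=(W,R)$ be a Kripke frame of finite height $h$ such that every cluster of $F$ has at most $N$ elements, for some finite $N\geq 1$. Then $F$ is properly refinable: every finite partition of $W$ has a finite refinement that is a proper partition of $F$. Moreover, $F$ is $f$-properly refinable for $$f(x)=\exp^h_2\bigl((N+h+1)(\log_2 x+N)\bigr),$$ i.e. every finite partition $\mathcal{A}$ of $W$ has a proper refinement $\mathcal{B}$ with $|\mathcal{B}|\leq f(|\mathcal{A}|)$.
   Context: A (Kripke) frame is a pair $(W,R)$ with $W$ nonempty and $R\subseteq W\times W$. $R^0$ is the identity on $W$, $R^{i+1}=R^i\circ R$, and $R^*=\bigcup_{i\geq 0}R^i$ is the reflexive transitive closure. Put $x\sim_R y$ iff $xR^*y$ and $yR^*x$; the $\sim_R$-classes are the clusters of the frame. The skeleton of $F$ is the partial order on clusters given by $[x]\leq_R[y]$ iff $xR^*y$. A partial order has height $h$ if it contains a chain of cardinality $h$ and no larger chain; the height of a frame is the height of its skeleton. A partition of $W$ is a family of pairwise disjoint nonempty sets with union $W$; a partition $\mathcal{B}$ is a refinement of $\mathcal{A}$ if every member of $\mathcal{B}$ is contained in some member of $\mathcal{A}$. A partition $\mathcal{A}$ of $W$ is proper (for $F$) if for all $U,V\in\mathcal{A}$: if $uRv$ for some $u\in U$, $v\in V$, then for every $u\in U$ there is $v\in V$ with $uRv$. $\exp^0_2(x)=x$ and $\exp^{i+1}_2(x)=2^{\exp^i_2(x)}$. *)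

theory Defs
  imports Complex_Main "HOL-Library.Disjoint_Sets"
begin

definition kripke_frame :: "'a set \<Rightarrow> 'a rel \<Rightarrow> bool" where
  "kripke_frame W R \<longleftrightarrow> W \<noteq> {} \<and> R \<subseteq> W \<times> W"

(* HOL's R\<^sup>* is reflexive on the whole type, hence the explicit restriction to W. *)
definition cluster_rel :: "'a set \<Rightarrow> 'a rel \<Rightarrow> 'a rel" where
  "cluster_rel W R = {(x, y) \<in> W \<times> W. (x, y) \<in> R\<^sup>* \<and> (y, x) \<in> R\<^sup>*}"

definition clusters :: "'a set \<Rightarrow> 'a rel \<Rightarrow> 'a set set" where
  "clusters W R = W // cluster_rel W R"

definition skeleton :: "'a set \<Rightarrow> 'a rel \<Rightarrow> 'a set rel" where
  "skeleton W R =
     {(cluster_rel W R `` {x}, cluster_rel W R `` {y}) | x y. x \<in> W \<and> y \<in> W \<and> (x, y) \<in> R\<^sup>*}"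

lemma equiv_cluster_rel: "equiv W (cluster_rel W R)"
  by (rule equivI) (auto simp: cluster_rel_def refl_on_def sym_def trans_def)

lemma skeleton_iff:
  assumes "x \<in> W" "y \<in> W"
  shows "(cluster_rel W R `` {x}, cluster_rel W R `` {y}) \<in> skeleton W R \<longleftrightarrow> (x, y) \<in> R\<^sup>*"
proof
  assume "(cluster_rel W R `` {x}, cluster_rel W R `` {y}) \<in> skeleton W R"
  then obtain x' y' where *: "x' \<in> W" "y' \<in> W" "(x', y') \<in> R\<^sup>*"
    "cluster_rel W R `` {x} = cluster_rel W R `` {x'}"
    "cluster_rel W R `` {y} = cluster_rel W R `` {y'}"
    by (auto simp: skeleton_def)
  then have "(x, x') \<in> cluster_rel W R" "(y, y') \<in> cluster_rel W R"
    using assms equiv_cluster_rel[of W R] by (auto simp: eq_equiv_class_iff)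
  with *(3) show "(x, y) \<in> R\<^sup>*"
    by (auto simp: cluster_rel_def)
qed (use assms in \<open>auto simp: skeleton_def\<close>)

lemma partial_order_on_skeleton: "partial_order_on (clusters W R) (skeleton W R)"
proof -
  have sub: "skeleton W R \<subseteq> clusters W R \<times> clusters W R"
    by (auto simp: skeleton_def clusters_def quotientI)
  have "refl_on (clusters W R) (skeleton W R)"
    by (auto simp: refl_on_def clusters_def skeleton_iff elim!: quotientE)
  moreover have "trans (skeleton W R)"
  proof (rule transI)
    fix A B C assume AB: "(A, B) \<in> skeleton W R" and BC: "(B, C) \<in> skeleton W R"
    then have "A \<in> clusters W R" "B \<in> clusters W R" "C \<in> clusters W R"
      using sub by auto
    with AB BC show "(A, C) \<in> skeleton W R"
      by (auto simp: clusters_def skeleton_iff elim!: quotientE)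
  qed
  moreover have "antisym (skeleton W R)"
  proof (rule antisymI)
    fix A B assume AB: "(A, B) \<in> skeleton W R" and BA: "(B, A) \<in> skeleton W R"
    then have "A \<in> clusters W R" "B \<in> clusters W R"
      using sub by auto
    then obtain x y where xy: "x \<in> W" "y \<in> W"
      "A = cluster_rel W R `` {x}" "B = cluster_rel W R `` {y}"
      by (auto simp: clusters_def elim!: quotientE)
    then have "(x, y) \<in> R\<^sup>*" "(y, x) \<in> R\<^sup>*"
      using AB BA by (simp_all add: skeleton_iff)
    with xy have "(x, y) \<in> cluster_rel W R"
      by (simp add: cluster_rel_def)
    then show "A = B"
      using xy equiv_class_eq[OF equiv_cluster_rel] by metis
  qed
  ultimately show ?thesis
    using sub by (auto simp: partial_order_on_def preorder_on_def)
qed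

(* Finiteness is demanded separately because card is 0 on infinite sets. *)
definition has_order_height :: "'a rel \<Rightarrow> nat \<Rightarrow> bool" where
  "has_order_height r h \<longleftrightarrow>
     (\<exists>C \<in> Chains r. finite C \<and> card C = h) \<and> (\<forall>C \<in> Chains r. finite C \<and> card C \<le> h)"

definition has_frame_height :: "'a set \<Rightarrow> 'a rel \<Rightarrow> nat \<Rightarrow> bool" where
  "has_frame_height W R h \<longleftrightarrow> has_order_height (skeleton W R) h"

definition proper_partition :: "'a set \<Rightarrow> 'a rel \<Rightarrow> 'a set set \<Rightarrow> bool" where
  "proper_partition W R P \<longleftrightarrow> partition_on W P \<and>
     (\<forall>U \<in> P. \<forall>V \<in> P. (\<exists>u \<in> U. \<exists>v \<in> V. (u, v) \<in> R) \<longrightarrow> (\<forall>u \<in> U. \<exists>v \<in> V. (u, v) \<in> R))"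

definition properly_refinable :: "'a set \<Rightarrow> 'a rel \<Rightarrow> bool" where
  "properly_refinable W R \<longleftrightarrow>
     (\<forall>P. partition_on W P \<and> finite P \<longrightarrow>
        (\<exists>Q. finite Q \<and> refines W Q P \<and> proper_partition W R Q))"

definition f_properly_refinable :: "(real \<Rightarrow> real) \<Rightarrow> 'a set \<Rightarrow> 'a rel \<Rightarrow> bool" where
  "f_properly_refinable f W R \<longleftrightarrow>
     (\<forall>P. partition_on W P \<and> finite P \<longrightarrow>
        (\<exists>Q. finite Q \<and> refines W Q P \<and> proper_partition W R Q \<and>
             real (card Q) \<le> f (real (card P))))"

primrec exp2_iter :: "nat \<Rightarrow> real \<Rightarrow> real" where
  "exp2_iter 0 x = x"
| "exp2_iter (Suc i) x = 2 powr exp2_iter i x"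

end

theory Submission
  imports Defs "HOL-Library.FuncSet"
begin

text \<open>
  The required refinement is the partition into classes of the coarsest bisimulation that respects
  the given partition: it is proper for free, so only its classes have to be counted. Peel off the
  frame into layers from the top. Enumerate the cluster of a point \<open>u\<close> by \<open>{..<N}\<close>, with
  repetitions and starting from \<open>u\<close>, and record the blocks of the enumerated points, the relation
  between them, and for each of them the set of classes it sees outside the cluster. Two points with
  the same record are bisimilar, so if there are \<open>s\<close> classes in the first \<open>d\<close> layers and \<open>x\<close> blocks,
  there are at most \<open>x\<^sup>N * 2\<^bsup>N*N\<^esup> * 2\<^bsup>N*s\<^esup>\<close> in the first \<open>d + 1\<close>.
\<close>

section \<open>Bisimilarity\<close>

text \<open>\<open>E\<close> stands for the equivalence whose classes are the blocks of the given
  partition, so \<open>Z \<subseteq> E\<close> takes the place of agreement on atoms.\<close>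

definition bisimulation :: "'a rel \<Rightarrow> 'a rel \<Rightarrow> 'a rel \<Rightarrow> bool" where
  "bisimulation E R Z \<longleftrightarrow> Z \<subseteq> E \<and>
     (\<forall>x y. (x, y) \<in> Z \<longrightarrow>
       (\<forall>v. (x, v) \<in> R \<longrightarrow> (\<exists>w. (y, w) \<in> R \<and> (v, w) \<in> Z)) \<and>
       (\<forall>w. (y, w) \<in> R \<longrightarrow> (\<exists>v. (x, v) \<in> R \<and> (v, w) \<in> Z)))"

definition bisimilar :: "'a rel \<Rightarrow> 'a rel \<Rightarrow> 'a \<Rightarrow> 'a \<Rightarrow> bool" where
  "bisimilar E R x y \<longleftrightarrow> (\<exists>Z. bisimulation E R Z \<and> (x, y) \<in> Z)"

lemma bisimilarD:
  assumes "bisimilar E R x y"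
  shows "(x, y) \<in> E"
    and "(x, v) \<in> R \<Longrightarrow> \<exists>w. (y, w) \<in> R \<and> bisimilar E R v w"
    and "(y, w) \<in> R \<Longrightarrow> \<exists>v. (x, v) \<in> R \<and> bisimilar E R v w"
  using assms unfolding bisimilar_def bisimulation_def by blast+

text \<open>Adding a relation \<open>X\<close> to bisimilarity yields a bisimulation even if
  successors are matched up to either of the two. The second disjunct serves successors that leave
  an enumerated cluster.\<close>

lemma bisimilar_coinduct [consumes 1, case_names bisimilar]:
  assumes "X x y"
    and step: "\<And>x y. X x y \<Longrightarrow> (x, y) \<in> E \<and>
      (\<forall>v. (x, v) \<in> R \<longrightarrow> (\<exists>w. (y, w) \<in> R \<and> (X v w \<or> bisimilar E R v w))) \<and>
      (\<forall>w. (y, w) \<in> R \<longrightarrow> (\<exists>v. (x, v) \<in> R \<and> (X v w \<or> bisimilar E R v w)))"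
  shows "bisimilar E R x y"
proof -
  define Z where "Z = {(x, y). X x y \<or> bisimilar E R x y}"
  have "bisimulation E R Z"
    unfolding bisimulation_def
  proof (intro conjI allI impI)
    show "Z \<subseteq> E"
      using step bisimilarD(1) by (fastforce simp: Z_def)
    show "\<exists>w. (y, w) \<in> R \<and> (v, w) \<in> Z" if "(x, y) \<in> Z" "(x, v) \<in> R" for x y v
      using that step[of x y] bisimilarD(2)[of E R x y v] by (auto simp: Z_def)
    show "\<exists>v. (x, v) \<in> R \<and> (v, w) \<in> Z" if "(x, y) \<in> Z" "(y, w) \<in> R" for x y w
      using that step[of x y] bisimilarD(3)[of E R x y w] by (auto simp: Z_def)
  qed
  with assms(1) show ?thesis by (auto simp: bisimilar_def Z_def)
qed

definition bisimilarity :: "'a rel \<Rightarrow> 'a rel \<Rightarrow> 'a rel" where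
  "bisimilarity E R = {(x, y). bisimilar E R x y}"

lemma bisimilar_refl:
  assumes "equiv W E" "R \<subseteq> W \<times> W" "x \<in> W"
  shows "bisimilar E R x x"
  using assms(3)
proof (coinduction arbitrary: x rule: bisimilar_coinduct)
  case bisimilar
  with assms(1,2) show ?case
    by (auto simp: equiv_def refl_on_def)
qed

lemma bisimilar_sym:
  assumes "sym E" "bisimilar E R x y"
  shows "bisimilar E R y x"
  using assms(2)
proof (coinduction arbitrary: x y rule: bisimilar_coinduct)
  case bisimilar
  then show ?case
    using bisimilarD[OF bisimilar] assms(1) by (metis symD)
qed

lemma bisimilar_trans:
  assumes "trans E" "bisimilar E R x y" "bisimilar E R y z"
  shows "bisimilar E R x z"
proof -
  \<comment> \<open>The relation for the coinduction is the composition of bisimilarity with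
    itself.\<close>
  have "\<exists>y. bisimilar E R x y \<and> bisimilar E R y z" using assms by blast
  then show ?thesis
  proof (coinduction arbitrary: x z rule: bisimilar_coinduct)
    case (bisimilar x z)
    then obtain y where xy: "bisimilar E R x y" and yz: "bisimilar E R y z" by blast
    have "(x, z) \<in> E"
      using bisimilarD(1)[OF xy] bisimilarD(1)[OF yz] assms(1) by (blast dest: transD)
    moreover have "\<exists>w. (z, w) \<in> R \<and> (\<exists>y. bisimilar E R v y \<and> bisimilar E R y w)"
      if "(x, v) \<in> R" for v
    proof -
      obtain u where "(y, u) \<in> R" "bisimilar E R v u" using bisimilarD(2)[OF xy \<open>(x, v) \<in> R\<close>] by blast
      with bisimilarD(2)[OF yz] show ?thesis by blast
    qed
    moreover have "\<exists>v. (x, v) \<in> R \<and> (\<exists>y. bisimilar E R v y \<and> bisimilar E R y w)"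
      if "(z, w) \<in> R" for w
    proof -
      obtain u where "(y, u) \<in> R" "bisimilar E R u w" using bisimilarD(3)[OF yz \<open>(z, w) \<in> R\<close>] by blast
      with bisimilarD(3)[OF xy] show ?thesis by blast
    qed
    ultimately show ?case by meson
  qed
qed

lemma equiv_bisimilarity:
  assumes E: "equiv W E" and R: "R \<subseteq> W \<times> W"
  shows "equiv W (bisimilarity E R)"
proof (rule equivI)
  show "bisimilarity E R \<subseteq> W \<times> W"
    using E by (auto simp: bisimilarity_def equiv_def dest!: bisimilarD(1))
  show "refl_on W (bisimilarity E R)"
    using bisimilar_refl[OF E R] by (auto simp: refl_on_def bisimilarity_def)
  show "sym (bisimilarity E R)"
    using bisimilar_sym[of E R] E by (auto simp: sym_def bisimilarity_def equiv_def)
  show "trans (bisimilarity E R)"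
    using bisimilar_trans[of E R] E unfolding trans_def bisimilarity_def equiv_def by blast
qed

text \<open>Properness is the forth clause: the matching successor is bisimilar to \<open>v\<close>,
  hence lies in the same class \<open>V\<close>.\<close>

lemma proper_partition_bisimilarity:
  assumes "equiv W E" "R \<subseteq> W \<times> W"
  shows "proper_partition W R (W // bisimilarity E R)"
proof -
  note eq = equiv_bisimilarity[OF assms]
  have "\<exists>v'\<in>V. (u', v') \<in> R"
    if "U \<in> W // bisimilarity E R" "V \<in> W // bisimilarity E R"
      "u \<in> U" "v \<in> V" "(u, v) \<in> R" "u' \<in> U" for U V u v u'
  proof -
    have "bisimilar E R u u'"
      using in_quotient_imp_in_rel[OF eq that(1), of u u'] that by (simp add: bisimilarity_def)
    with that(5) obtain v' where v': "(u', v') \<in> R" "(v, v') \<in> bisimilarity E R"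
      by (auto dest: bisimilarD(2) simp: bisimilarity_def)
    then show ?thesis
      using in_quotient_imp_closed[OF eq that(2,4)] by blast
  qed
  then show ?thesis
    using partition_on_quotient[OF eq] unfolding proper_partition_def by blast
qed

lemma refines_bisimilarity:
  assumes P: "partition_on W P" and E: "equiv W E" "W // E = P" and R: "R \<subseteq> W \<times> W"
  shows "refines W (W // bisimilarity E R) P"
proof -
  have "\<exists>A\<in>P. U \<subseteq> A" if U: "U \<in> W // bisimilarity E R" for U
  proof -
    from U obtain x where "x \<in> W" "U = bisimilarity E R `` {x}" by (rule quotientE)
    moreover have "bisimilarity E R `` {x} \<subseteq> E `` {x}"
      by (auto simp: bisimilarity_def dest: bisimilarD(1))
    ultimately show ?thesis using E(2) by (auto intro: quotientI)
  qed
  then show ?thesis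
    using P partition_on_quotient[OF equiv_bisimilarity[OF E(1) R]] by (auto simp: refines_def)
qed

section \<open>Codes of enumerated sets\<close>

text \<open>Both functions are restricted to \<open>{..<N}\<close>, so that codes lie in a product
  of \<open>PiE\<close> sets and a powerset and can be counted.\<close>

definition enum_code :: "'a rel \<Rightarrow> 'a rel \<Rightarrow> nat \<Rightarrow> (nat \<Rightarrow> 'a)
    \<Rightarrow> (nat \<Rightarrow> 'a set) \<times> (nat \<times> nat) set \<times> (nat \<Rightarrow> 'a set set)" where
  "enum_code E R N e =
     (\<lambda>i\<in>{..<N}. E `` {e i},
      {(i, j) \<in> {..<N} \<times> {..<N}. (e i, e j) \<in> R},
      \<lambda>i\<in>{..<N}. (\<lambda>v. bisimilarity E R `` {v}) ` {v. (e i, v) \<in> R \<and> v \<notin> e ` {..<N}})"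

text \<open>A successor inside the enumerated set is matched by the point with the same index,
  through the second component; one outside is matched by a point of the same class, through the
  third.\<close>

lemma enum_code_step:
  assumes E: "equiv W E" and R: "R \<subseteq> W \<times> W"
    and code: "enum_code E R N e = enum_code E R N e'"
    and i: "i < N" and v: "(e i, v) \<in> R"
  shows "\<exists>w. (e' i, w) \<in> R \<and> ((\<exists>j<N. v = e j \<and> w = e' j) \<or> bisimilar E R v w)"
proof (cases "v \<in> e ` {..<N}")
  case True
  then obtain j where "j < N" "v = e j" by auto
  moreover have "(i, j) \<in> {(i, j) \<in> {..<N} \<times> {..<N}. (e i, e j) \<in> R}"
    using i v calculation by simp
  then have "(e' i, e' j) \<in> R"
    using code by (auto simp: enum_code_def)
  ultimately show ?thesis by blast
next
  case False
  let ?F = "\<lambda>e. (\<lambda>v. bisimilarity E R `` {v}) ` {v. (e i, v) \<in> R \<and> v \<notin> e ` {..<N}}"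
  have "?F e = ?F e'"
    using code i by (auto simp: enum_code_def dest!: fun_cong[where x = i])
  moreover have "bisimilarity E R `` {v} \<in> ?F e" using False v by blast
  ultimately obtain w where w: "(e' i, w) \<in> R" "bisimilarity E R `` {v} = bisimilarity E R `` {w}"
    by auto
  then have "(v, w) \<in> bisimilarity E R"
    using eq_equiv_class[OF _ equiv_bisimilarity[OF E R]] R by blast
  then show ?thesis using w by (auto simp: bisimilarity_def)
qed

text \<open>Pairing \<open>e i\<close> with \<open>e' i\<close> is a bisimulation up to
  bisimilarity. Equality of codes is symmetric, so the back clause is the forth clause with the
  enumerations exchanged. Repetitions are harmless because points are matched by index.\<close>

lemma bisimilar_if_enum_code_eq:
  assumes E: "equiv W E" and R: "R \<subseteq> W \<times> W"
    and code: "enum_code E R N e = enum_code E R N e'"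
    and W: "e' ` {..<N} \<subseteq> W"
    and i: "i < N"
  shows "bisimilar E R (e i) (e' i)"
  using i
proof (coinduction arbitrary: i rule: bisimilar_coinduct)
  case (bisimilar k)
  have "E `` {e k} = E `` {e' k}"
    using code bisimilar by (auto simp: enum_code_def dest!: fun_cong[where x = k])
  then have "(e k, e' k) \<in> E"
    using eq_equiv_class[OF _ E] W bisimilar by blast
  moreover note enum_code_step[OF E R code bisimilar]
  moreover have "\<exists>v. (e k, v) \<in> R \<and> ((\<exists>j<N. v = e j \<and> w = e' j) \<or> bisimilar E R v w)"
    if "(e' k, w) \<in> R" for w
    using enum_code_step[OF E R code[symmetric] bisimilar that] bisimilar_sym[of E R] E
    by (auto simp: equiv_def)
  ultimately show ?case by meson
qed

section \<open>Layers\<close>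

text \<open>Layer \<open>d\<close> is cumulative: it holds the points whose cluster starts no
  ascending chain of more than \<open>d\<close> clusters.\<close>

primrec layers :: "'a set \<Rightarrow> 'a rel \<Rightarrow> nat \<Rightarrow> 'a set" where
  "layers W R 0 = {}"
| "layers W R (Suc d) =
     {x \<in> W. \<forall>y. (x, y) \<in> R\<^sup>* \<and> (y, x) \<notin> R\<^sup>* \<longrightarrow> y \<in> layers W R d}"

lemma rtrancl_in_carrier:
  assumes "R \<subseteq> W \<times> W" "x \<in> W" "(x, y) \<in> R\<^sup>*"
  shows "y \<in> W"
  using assms(3) by (rule rtranclE) (use assms(1,2) in auto)

text \<open>A point outside layer \<open>Suc d\<close> has a strict successor outside layer
  \<open>d\<close>; its own cluster is put below the chain found there. That the start is the least
  element of the chain is carried along to make the new cluster comparable with all others and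
  distinct from them.\<close>

lemma chain_if_not_in_layers:
  assumes R: "R \<subseteq> W \<times> W" and "x \<in> W" "x \<notin> layers W R d"
  shows "\<exists>C \<in> Chains (skeleton W R). finite C \<and> card C = Suc d \<and>
    (\<forall>A \<in> C. (cluster_rel W R `` {x}, A) \<in> skeleton W R)"
  using assms(2,3)
proof (induction d arbitrary: x)
  case 0
  then have "(cluster_rel W R `` {x}, cluster_rel W R `` {x}) \<in> skeleton W R"
    by (simp add: skeleton_iff)
  then show ?case
    by (intro bexI[of _ "{cluster_rel W R `` {x}}"]) (auto simp: Chains_def)
next
  case (Suc d)
  let ?c = "\<lambda>x. cluster_rel W R `` {x}"
  from Suc.prems obtain y where y: "(x, y) \<in> R\<^sup>*" "(y, x) \<notin> R\<^sup>*" "y \<notin> layers W R d"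
    by auto
  have "y \<in> W" using rtrancl_in_carrier[OF R Suc.prems(1) y(1)] .
  from Suc.IH[OF this y(3)] obtain C where
    C: "C \<in> Chains (skeleton W R)" "finite C" "card C = Suc d"
      "\<forall>A \<in> C. (?c y, A) \<in> skeleton W R" by blast
  have xy: "(?c x, ?c y) \<in> skeleton W R"
    using skeleton_iff Suc.prems(1) \<open>y \<in> W\<close> y(1) by metis
  have "(?c y, ?c x) \<notin> skeleton W R"
    using skeleton_iff Suc.prems(1) \<open>y \<in> W\<close> y(2) by metis
  then have "?c x \<notin> C" using C(4) by blast
  have "trans (skeleton W R)"
    using partial_order_on_skeleton[of W R]
    by (auto simp: partial_order_on_def preorder_on_def)
  then have above: "\<forall>A \<in> insert (?c x) C. (?c x, A) \<in> skeleton W R"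
    using C(4) xy skeleton_iff[OF Suc.prems(1) Suc.prems(1)] by (auto dest: transD)
  then have "insert (?c x) C \<in> Chains (skeleton W R)"
    using C(1) by (auto simp: Chains_def)
  with above C \<open>?c x \<notin> C\<close> show ?case
    by (intro bexI[of _ "insert (?c x) C"]) auto
qed

lemma layers_height:
  assumes "R \<subseteq> W \<times> W" "has_frame_height W R h"
  shows "layers W R h = W"
proof
  show "layers W R h \<subseteq> W" by (cases h) auto
  show "W \<subseteq> layers W R h"
  proof
    fix x assume "x \<in> W"
    show "x \<in> layers W R h"
    proof (rule ccontr)
      assume "x \<notin> layers W R h"
      from chain_if_not_in_layers[OF assms(1) \<open>x \<in> W\<close> this] obtain C
        where C: "C \<in> Chains (skeleton W R)" "card C = Suc h" by blast
      then have "card C \<le> h"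
        using assms(2) unfolding has_frame_height_def has_order_height_def by blast
      with C show False by simp
    qed
  qed
qed

section \<open>Counting the classes of one more layer\<close>

lemma surj_enum_from:
  assumes "finite C" "card C \<le> N" "u \<in> C"
  shows "\<exists>e. e ` {..<N} = C \<and> e (0::nat) = u"
proof -
  obtain ys where ys: "set ys = C - {u}" "distinct ys"
    using finite_distinct_list[of "C - {u}"] assms(1) by auto
  define xs where "xs = u # ys"
  have xs: "set xs = C" using ys assms(3) by (auto simp: xs_def)
  have len: "length xs = card C"
    using xs ys distinct_card[of xs] by (simp add: xs_def)
  \<comment> \<open>The default \<open>u\<close> pads the enumeration without leaving
    \<open>C\<close> when \<open>C\<close> has fewer than \<open>N\<close> elements.\<close>
  define e where "e = (\<lambda>i. if i < length xs then xs ! i else u)"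
  have "C \<subseteq> e ` {..<N}"
  proof
    fix v assume "v \<in> C"
    then obtain i where "i < length xs" "v = xs ! i"
      using xs by (metis in_set_conv_nth)
    then show "v \<in> e ` {..<N}" using len assms(2) by (intro image_eqI[of _ _ i]) (auto simp: e_def)
  qed
  moreover have "e ` {..<N} \<subseteq> C" using xs assms(3) by (auto simp: e_def)
  moreover have "e 0 = u" by (simp add: e_def xs_def)
  ultimately show ?thesis by blast
qed

text \<open>Bisimilarity classes in the new layer are determined by codes, and the three factors of
  the bound count the possible values of the three components.\<close>

lemma card_layer_step:
  assumes E: "equiv W E" "finite (W // E)" and R: "R \<subseteq> W \<times> W"
    and N: "N \<ge> 1" "\<forall>C \<in> clusters W R. finite C \<and> card C \<le> N"
    and fin: "finite ((\<lambda>x. bisimilarity E R `` {x}) ` layers W R d)"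
  shows "finite ((\<lambda>x. bisimilarity E R `` {x}) ` layers W R (Suc d))"
    and "card ((\<lambda>x. bisimilarity E R `` {x}) ` layers W R (Suc d)) \<le>
      card (W // E) ^ N *
      (2 ^ (N * N) * (2 ^ card ((\<lambda>x. bisimilarity E R `` {x}) ` layers W R d)) ^ N)"
proof -
  let ?L = "layers W R (Suc d)" and ?cl = "\<lambda>x. bisimilarity E R `` {x}"
  let ?S = "?cl ` layers W R d"
  let ?C = "\<lambda>u. cluster_rel W R `` {u}"
  have "\<forall>u\<in>W. \<exists>e. e ` {..<N} = ?C u \<and> e 0 = u"
  proof
    fix u assume u: "u \<in> W"
    then have "?C u \<in> clusters W R" unfolding clusters_def by (rule quotientI)
    moreover have "u \<in> ?C u" using u by (simp add: cluster_rel_def)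
    ultimately show "\<exists>e. e ` {..<N} = ?C u \<and> e 0 = u"
      using N(2) by (intro surj_enum_from) auto
  qed
  then obtain e where e: "\<And>u. u \<in> W \<Longrightarrow> e u ` {..<N} = ?C u" "\<And>u. u \<in> W \<Longrightarrow> e u 0 = u"
    by metis
  have eW: "e u ` {..<N} \<subseteq> W" if "u \<in> W" for u
    using e(1)[OF that] by (auto simp: cluster_rel_def)
  define code where "code = (\<lambda>u. enum_code E R N (e u))"
  define K where "K = ({..<N} \<rightarrow>\<^sub>E W // E) \<times> Pow ({..<N} \<times> {..<N}) \<times> ({..<N} \<rightarrow>\<^sub>E Pow ?S)"
  \<comment> \<open>A successor that leaves the cluster of \<open>u\<close> cannot return to it, so
    it lies in the previous layer. This keeps the third component within
    \<open>Pow ?S\<close>.\<close>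
  have outside: "v \<in> layers W R d"
    if u: "u \<in> ?L" and i: "i < N" and v: "(e u i, v) \<in> R" "v \<notin> e u ` {..<N}" for u i v
  proof -
    have "u \<in> W" using u by simp
    then have "(u, e u i) \<in> cluster_rel W R" using e(1) i by blast
    then have ui: "(u, v) \<in> R\<^sup>*" using v(1) by (auto simp: cluster_rel_def)
    moreover have "v \<in> W" using v R by blast
    then have "(v, u) \<notin> R\<^sup>*"
      using ui \<open>u \<in> W\<close> v(2) e(1)[OF \<open>u \<in> W\<close>] by (auto simp: cluster_rel_def)
    ultimately show ?thesis using u by simp
  qed
  have code_K: "code ` ?L \<subseteq> K"
  proof
    fix k assume "k \<in> code ` ?L"
    then obtain u where u: "u \<in> ?L" "k = code u" by blast
    then have "u \<in> W" by simp
    show "k \<in> K"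
      using eW[OF \<open>u \<in> W\<close>] outside[OF u(1)] unfolding u(2) code_def enum_code_def K_def
      by (auto intro!: quotientI restrict_PiE_iff[THEN iffD2])
  qed
  have finK: "finite K"
    using E(2) fin by (auto simp: K_def intro!: finite_PiE)
  have cardK: "card K = card (W // E) ^ N * (2 ^ (N * N) * (2 ^ card ?S) ^ N)"
    using fin by (simp add: K_def card_cartesian_product card_PiE card_Pow)
  define g where "g = (\<lambda>k. ?cl (SOME u. u \<in> ?L \<and> code u = k))"
  have "?cl u = g (code u)" if u: "u \<in> ?L" for u
  proof -
    define u' where "u' = (SOME u'. u' \<in> ?L \<and> code u' = code u)"
    have "u' \<in> ?L \<and> code u' = code u"
      unfolding u'_def by (rule someI[of _ u]) (use u in blast)
    then have u': "u' \<in> ?L" "code u' = code u" by blast+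
    have "u \<in> W" "u' \<in> W" using u u'(1) by auto
    \<comment> \<open>Index 0 recovers the points themselves, so the class does not depend on the
      representative chosen by \<open>g\<close>.\<close>
    then have "bisimilar E R (e u 0) (e u' 0)"
      using bisimilar_if_enum_code_eq[OF E(1) R _ eW[of u']] u'(2) N(1) by (simp add: code_def)
    then have "(u, u') \<in> bisimilarity E R"
      using e(2) \<open>u \<in> W\<close> \<open>u' \<in> W\<close> by (simp add: bisimilarity_def)
    then show ?thesis
      using equiv_class_eq[OF equiv_bisimilarity[OF E(1) R]]
      by (simp add: g_def u'_def del: layers.simps)
  qed
  then have T: "?cl ` ?L = g ` code ` ?L" by (simp add: image_image)
  have fc: "finite (code ` ?L)" using finite_subset[OF code_K finK] .
  show "finite (?cl ` ?L)" using fc T by simp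
  have "card (?cl ` ?L) \<le> card (code ` ?L)" unfolding T by (rule card_image_le[OF fc])
  also have "\<dots> \<le> card K" by (rule card_mono[OF finK code_K])
  finally show "card (?cl ` ?L) \<le> card (W // E) ^ N * (2 ^ (N * N) * (2 ^ card ?S) ^ N)"
    unfolding cardK .
qed

section \<open>Iterated exponentials\<close>

lemma Suc_le_two_power: "1 + real n \<le> 2 ^ n"
  by (induction n) (auto intro: order_trans)

lemma less_two_powr: "x < 2 powr (x::real)"
proof (cases "x < 0")
  case True
  then show ?thesis using powr_gt_zero[of 2 x] by linarith
next
  case False
  then have "x < 1 + real (nat \<lfloor>x\<rfloor>)" by linarith
  also have "\<dots> \<le> 2 ^ nat \<lfloor>x\<rfloor>"
    by (rule Suc_le_two_power)
  also have "\<dots> = 2 powr real (nat \<lfloor>x\<rfloor>)" by (simp add: powr_realpow)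
  also have "\<dots> \<le> 2 powr x" using False by (intro powr_mono) linarith+
  finally show ?thesis .
qed

lemma le_exp2_iter: "x \<le> exp2_iter d x"
proof (induction d)
  case (Suc d)
  then show ?case using less_two_powr[of "exp2_iter d x"] by simp
qed simp

text \<open>An increment of at least 1 survives each exponentiation:
  \<open>2^a + y \<le> 2^a * (1 + y) \<le> 2^(a + y)\<close> for \<open>a \<ge> 0\<close>.\<close>

lemma exp2_iter_add:
  assumes "x \<ge> 0" "y \<ge> 1"
  shows "exp2_iter d x + y \<le> exp2_iter d (x + y)"
proof (induction d)
  case (Suc d)
  let ?e = "exp2_iter d x"
  have e: "?e \<ge> 0" using le_exp2_iter[of x d] assms by linarith
  \<comment> \<open>The tangent of \<open>2^t\<close> at 0 and \<open>ln 2 \<ge> 1/2\<close> give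
    \<open>2^(y - 1) \<ge> (1 + y) / 2\<close>.\<close>
  have "1 + (y - 1) * ln 2 \<le> 2 powr (y - 1)"
    using exp_ge_add_one_self[of "(y - 1) * ln 2"] by (simp add: powr_def)
  moreover have "(y - 1) * (1 / 2) \<le> (y - 1) * ln 2"
    using assms(2) ln_le_minus_one[of "1 / 2"] by (intro mult_left_mono) (auto simp: ln_div)
  ultimately have y: "1 + y \<le> 2 powr y"
    by (simp add: powr_diff)
  have "2 powr ?e + y \<le> 2 powr ?e * (1 + y)"
    using mult_right_mono[OF ge_one_powr_ge_zero[of 2 ?e], of y] e assms by (simp add: algebra_simps)
  also have "\<dots> \<le> 2 powr ?e * 2 powr y" using y by (intro mult_left_mono) auto
  also have "\<dots> = 2 powr (?e + y)" by (simp add: powr_add)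
  also have "\<dots> \<le> 2 powr (exp2_iter d (x + y))" using Suc by simp
  finally show ?case by simp
qed simp

text \<open>The cost of a further layer is one more \<open>L\<close> in the innermost argument. The
  tower absorbs \<open>N * L\<close>; the remaining factor \<open>1 + N \<le> 2^L\<close> becomes a
  summand \<open>L\<close> in the exponent, and \<open>exp2_iter_add\<close> moves it
  inward.\<close>

lemma exp2_iter_step:
  assumes N: "N \<ge> 1" and L: "L \<ge> real N" and d: "d \<ge> 1"
  defines "y \<equiv> (real N + real d + 1) * L"
  shows "real N * (L + exp2_iter d y) \<le> exp2_iter d (y + L)"
proof -
  obtain d' where d': "d = Suc d'" using d by (cases d) auto
  let ?e = "exp2_iter d y"
  have y: "y \<ge> real N * L" "y \<ge> 0" using N L by (auto simp: y_def algebra_simps)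
  have "real N * L \<le> ?e" using y(1) le_exp2_iter[of y d] by linarith
  then have "real N * (L + ?e) \<le> (1 + real N) * ?e" by (simp add: algebra_simps)
  moreover have "1 + real N \<le> 2 powr L"
    using Suc_le_two_power[of N] powr_mono[OF L, of 2] by (simp add: powr_realpow)
  then have "(1 + real N) * ?e \<le> 2 powr L * ?e"
    by (rule mult_right_mono) (simp add: d')
  ultimately have "real N * (L + ?e) \<le> 2 powr L * ?e" by linarith
  also have "\<dots> = 2 powr (exp2_iter d' y + L)" by (simp add: d' powr_add)
  also have "\<dots> \<le> exp2_iter d (y + L)" using exp2_iter_add[OF y(2), of L d'] N L by (simp add: d')
  finally show ?thesis .
qed

theorem theorem1:
  fixes W :: "'a set" and R :: "'a rel" and h N :: nat
  assumes "kripke_frame W R"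
    and "has_frame_height W R h"
    and "N \<ge> 1"
    and "\<forall>C \<in> clusters W R. finite C \<and> card C \<le> N"
  shows "properly_refinable W R \<and>
         f_properly_refinable
           (\<lambda>x. exp2_iter h ((real N + real h + 1) * (log 2 x + real N))) W R"
proof -
  have R: "R \<subseteq> W \<times> W" and W: "W \<noteq> {}" using assms(1) by (auto simp: kripke_frame_def)
  have "\<exists>Q. finite Q \<and> refines W Q P \<and> proper_partition W R Q \<and>
      real (card Q) \<le> exp2_iter h ((real N + real h + 1) * (log 2 (real (card P)) + real N))"
    if P: "partition_on W P" "finite P" for P
  proof -
    define E where "E = {(x, y). \<exists>A\<in>P. x \<in> A \<and> y \<in> A}"
    have E: "equiv W E" "W // E = P"
      unfolding E_def using P(1) by (auto intro: equiv_partition_on simp: partition_on_eq_quotient)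
    define S where "S d = (\<lambda>x. bisimilarity E R `` {x}) ` layers W R d" for d
    define L where "L = log 2 (real (card P)) + real N"
    have "P \<noteq> {}" using W P(1) by (auto simp: partition_on_def)
    then have P1: "card P \<ge> 1" using P(2) by (simp add: Suc_leI card_gt_0_iff)
    then have L: "L \<ge> real N" by (simp add: L_def)
    have fin: "finite (S d)" for d
    proof (induction d)
      case (Suc d)
      then show ?case
        unfolding S_def using card_layer_step(1)[OF E(1) _ R assms(3,4)] E(2) P(2) by simp
    qed (simp add: S_def)
    have step: "real (card (S (Suc d))) \<le> 2 powr (real N * (L + real (card (S d))))" for d
    proof -
      have "card (S (Suc d)) \<le> card P ^ N * (2 ^ (N * N) * (2 ^ card (S d)) ^ N)"
        unfolding S_def
        using card_layer_step(2)[OF E(1) _ R assms(3,4)] E(2) P(2) fin[of d] by (simp add: S_def)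
      then have "real (card (S (Suc d))) \<le>
          real (card P) ^ N * (2 ^ (N * N) * (2 ^ card (S d)) ^ N)"
        by (metis (mono_tags, lifting) of_nat_le_iff of_nat_mult of_nat_numeral of_nat_power)
      \<comment> \<open>All three factors are \<open>N\<close>-th powers, with
        \<open>2^(N * N) = (2^N)^N\<close>. This is the source of the summand \<open>N\<close> in
        \<open>L\<close>.\<close>
      also have "\<dots> = (2 powr (L + real (card (S d)))) ^ N"
        using P1 by (simp add: L_def powr_add powr_realpow power_mult_distrib power_mult)
      also have "\<dots> = 2 powr (real N * (L + real (card (S d))))"
        by (simp add: powr_powr mult.commute flip: powr_realpow)
      finally show ?thesis .
    qed
    \<comment> \<open>The induction starts at the first layer because \<open>exp2_iter_step\<close>
      needs an outermost exponential.\<close>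
    have bound: "real (card (S (Suc d))) \<le>
        exp2_iter (Suc d) ((real N + real (Suc d) + 1) * L)" for d
    proof (induction d)
      case 0
      have "real (card (S 1)) \<le> 2 powr (real N * L)"
        using step[of 0] by (simp add: S_def)
      also have "\<dots> \<le> 2 powr ((real N + 2) * L)" using L by (simp add: mult_right_mono)
      finally show ?case by (simp add: add.commute)
    next
      case (Suc d)
      let ?y = "(real N + real (Suc d) + 1) * L"
      have "real N * (L + real (card (S (Suc d)))) \<le> real N * (L + exp2_iter (Suc d) ?y)"
        using Suc by (intro mult_left_mono) auto
      also have "\<dots> \<le> exp2_iter (Suc d) (?y + L)"
        using exp2_iter_step[OF assms(3) L, of "Suc d"] by simp
      also have "?y + L = (real N + real (Suc (Suc d)) + 1) * L" by (simp add: algebra_simps)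
      finally have "2 powr (real N * (L + real (card (S (Suc d))))) \<le>
          exp2_iter (Suc (Suc d)) ((real N + real (Suc (Suc d)) + 1) * L)"
        by simp
      with step[of "Suc d"] show ?case by linarith
    qed
    have S: "S h = W // bisimilarity E R"
      using layers_height[OF R assms(2)] by (auto simp: S_def quotient_def)
    \<comment> \<open>Layer 0 is empty while layer \<open>h\<close> is the nonempty
      \<open>W\<close>.\<close>
    have "h \<noteq> 0" using layers_height[OF R assms(2)] W by (cases h) auto
    then have "real (card (S h)) \<le> exp2_iter h ((real N + real h + 1) * L)"
      using bound[of "h - 1"] by simp
    then show ?thesis
      using fin[of h] refines_bisimilarity[OF P(1) E R] proper_partition_bisimilarity[OF E(1) R]
      unfolding S L_def by blast
  qed
  then show ?thesis
    unfolding properly_refinable_def f_properly_refinable_def by blast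
qed

end
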